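(* Every finite-dimensional simple left $\mathcal{B}$-module is isomorphic to $\Bbbk^1_a$ for a unique $a\in\Bbbk$, where $\Bbbk^1_a$ denotes the one-dimensional $\mathcal{B}$-module on which $x_1$ acts by $0$ and $x_2$ acts by the scalar $a$.
   Context: $\Bbbk$ is an algebraically closed field of characteristic $0$. The super Jordan plane $\mathcal{B}$ is the associative unital $\Bbbk$-algebra generated by $x_1,x_2$ with defining relations $x_1^2=0$ and $x_2x_{21}=x_{21}x_2+x_1x_{21}$, where $x_{21}:=x_1x_2+x_2x_1$. *)

theory Defs
  imports
    "HOL-Computational_Algebra.Polynomial"
    "HOL-Library.Poly_Mapping"
begin

section \<open>Free associative algebras\<close>

text \<open>
  The product on \<^typ>\<open>'a \<Rightarrow>\<^sub>0 'b\<close> is convolution with respect to the additively written monoid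
  structure of the index type.  Lists carry no such structure in the library, so words are wrapped:
  here \<open>+\<close> is concatenation and hence not commutative.  The free unital associative \<open>'k\<close>-algebra on
  the set of all elements of \<open>'g\<close> is then \<open>'g word \<Rightarrow>\<^sub>0 'k\<close>.
\<close>

datatype 'g word = Word (letters: "'g list")

instantiation word :: (type) monoid_add
begin

definition zero_word :: "'a word" where
  "0 = Word []"

definition plus_word :: "'a word \<Rightarrow> 'a word \<Rightarrow> 'a word" where
  "u + v = Word (letters u @ letters v)"

instance
  by standard (simp_all add: zero_word_def plus_word_def)

end

lemma letters_zero [simp]: "letters 0 = []"
  by (simp add: zero_word_def)

type_synonym ('g, 'k) free_algebra = "'g word \<Rightarrow>\<^sub>0 'k"

definition free_scalar :: "'k::zero \<Rightarrow> ('g, 'k) free_algebra" where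
  "free_scalar c = Poly_Mapping.single 0 c"

definition free_gen :: "'g \<Rightarrow> ('g, 'k::zero_neq_one) free_algebra" where
  "free_gen x = Poly_Mapping.single (Word [x]) 1"

definition free_eval :: "('g \<Rightarrow> 'k::comm_ring_1) \<Rightarrow> ('g, 'k) free_algebra \<Rightarrow> 'k" where
  "free_eval g p =
     (\<Sum>w\<in>Poly_Mapping.keys p. Poly_Mapping.lookup p w * prod_list (map g (letters w)))"

lemma free_eval_superset:
  assumes "finite A" "Poly_Mapping.keys p \<subseteq> A"
  shows "free_eval g p =
    (\<Sum>w\<in>A. Poly_Mapping.lookup p w * prod_list (map g (letters w)))"
  unfolding free_eval_def using assms
  by (intro sum.mono_neutral_left) (auto simp: in_keys_iff)

lemma free_eval_single [simp]:
  "free_eval g (Poly_Mapping.single w c) = c * prod_list (map g (letters w))"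
  by (subst free_eval_superset[of "{w}"]) auto

lemma free_eval_zero [simp]: "free_eval g 0 = 0"
  by (simp add: free_eval_def)

lemma free_eval_add: "free_eval g (p + q) = free_eval g p + free_eval g q"
proof -
  let ?A = "Poly_Mapping.keys p \<union> Poly_Mapping.keys q"
  have "Poly_Mapping.keys (p + q) \<subseteq> ?A" by (rule keys_add)
  then show ?thesis
    by (simp add: free_eval_superset[of ?A] lookup_add distrib_right sum.distrib)
qed

lemma free_eval_one [simp]: "free_eval g 1 = 1"
  using free_eval_single[of g 0 1] by simp

lemma free_algebra_induct [case_names single add]:
  assumes single: "\<And>w c. P (Poly_Mapping.single w c)"
    and add: "\<And>p q. P p \<Longrightarrow> P q \<Longrightarrow> P (p + q)"
  shows "P (p :: ('g, 'k::comm_ring_1) free_algebra)"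
proof (induction p rule: update_induct)
  case const
  show ?case using single[of 0 0] by simp
next
  case (update p w c)
  have "Poly_Mapping.update w c p = p + Poly_Mapping.single w c"
    using update(1)
    by (intro poly_mapping_eqI)
       (auto simp: lookup_update lookup_add lookup_single in_keys_iff "when_def")
  then show ?case using add[OF update(3) single] by simp
qed

lemma free_eval_mult: "free_eval g (p * q) = free_eval g p * free_eval g q"
proof (induction p rule: free_algebra_induct)
  case (single u c)
  show ?case
    by (induction q rule: free_algebra_induct)
       (simp_all add: mult_single plus_word_def distrib_left free_eval_add algebra_simps)
next
  case (add p1 p2)
  then show ?case by (simp add: distrib_right free_eval_add)
qed

lemma free_eval_minus: "free_eval g (- p) = - free_eval g p"
proof -
  have "free_eval g (- p) + free_eval g p = 0"
    by (simp flip: free_eval_add)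
  then show ?thesis by (simp add: eq_neg_iff_add_eq_0)
qed

lemma free_eval_diff: "free_eval g (p - q) = free_eval g p - free_eval g q"
  using free_eval_add[of g p "- q"] by (simp add: free_eval_minus)

inductive_set two_sided_ideal :: "'r::ring_1 set \<Rightarrow> 'r set" for R where
  zero: "0 \<in> two_sided_ideal R"
| gen: "r \<in> R \<Longrightarrow> p * r * q \<in> two_sided_ideal R"
| add: "a \<in> two_sided_ideal R \<Longrightarrow> b \<in> two_sided_ideal R \<Longrightarrow> a + b \<in> two_sided_ideal R"

lemma two_sided_ideal_mult_left: "a \<in> two_sided_ideal R \<Longrightarrow> p * a \<in> two_sided_ideal R"
proof (induction rule: two_sided_ideal.induct)
  case (gen r p' q)
  then show ?case using two_sided_ideal.gen[of r R "p * p'" q] by (simp add: mult.assoc)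
qed (auto simp: distrib_left intro: two_sided_ideal.intros)

lemma two_sided_ideal_mult_right: "a \<in> two_sided_ideal R \<Longrightarrow> a * p \<in> two_sided_ideal R"
proof (induction rule: two_sided_ideal.induct)
  case (gen r p' q)
  then show ?case using two_sided_ideal.gen[of r R p' "q * p"] by (simp add: mult.assoc)
qed (auto simp: distrib_right intro: two_sided_ideal.intros)

lemma two_sided_ideal_minus: "a \<in> two_sided_ideal R \<Longrightarrow> - a \<in> two_sided_ideal R"
  using two_sided_ideal_mult_left[of a R "- 1"] by simp

lemma two_sided_ideal_base: "r \<in> R \<Longrightarrow> r \<in> two_sided_ideal R"
  using two_sided_ideal.gen[of r R 1 1] by simp

section \<open>The super Jordan plane\<close>

datatype sjp_gen = G1 | G2

definition sjp_relators :: "(sjp_gen, 'k::comm_ring_1) free_algebra set" where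
  "sjp_relators =
     (let x1 = free_gen G1; x2 = free_gen G2; x21 = x1 * x2 + x2 * x1
      in {x1 * x1, x2 * x21 - (x21 * x2 + x1 * x21)})"

definition sjp_rel ::
    "(sjp_gen, 'k::comm_ring_1) free_algebra \<Rightarrow> (sjp_gen, 'k) free_algebra \<Rightarrow> bool" where
  "sjp_rel p q \<longleftrightarrow> p - q \<in> two_sided_ideal sjp_relators"

lemma equivp_sjp_rel: "equivp (sjp_rel :: (sjp_gen, 'k::comm_ring_1) free_algebra \<Rightarrow> _)"
proof (rule equivpI)
  show "reflp sjp_rel"
    by (auto simp: reflp_def sjp_rel_def intro: two_sided_ideal.zero)
  show "symp sjp_rel"
    unfolding symp_def sjp_rel_def by (metis minus_diff_eq two_sided_ideal_minus)
  show "transp (sjp_rel :: (sjp_gen, 'k) free_algebra \<Rightarrow> _)"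
  proof (rule transpI)
    fix p q r :: "(sjp_gen, 'k) free_algebra"
    assume "sjp_rel p q" "sjp_rel q r"
    then have "(p - q) + (q - r) \<in> two_sided_ideal sjp_relators"
      unfolding sjp_rel_def by (rule two_sided_ideal.add)
    then show "sjp_rel p r"
      by (simp add: sjp_rel_def)
  qed
qed

quotient_type (overloaded) 'k super_jordan_plane =
  "(sjp_gen, 'k::comm_ring_1) free_algebra" / sjp_rel
  by (rule equivp_sjp_rel)

fun sjp_values :: "'k::comm_ring_1 \<Rightarrow> sjp_gen \<Rightarrow> 'k" where
  "sjp_values a G1 = 0"
| "sjp_values a G2 = a"

lemma free_eval_sjp_ideal:
  assumes "p \<in> two_sided_ideal sjp_relators"
  shows "free_eval (sjp_values a) p = 0"
  using assms
proof (induction rule: two_sided_ideal.induct)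
  case (gen r p q)
  then have "free_eval (sjp_values a) r = 0"
    by (auto simp: sjp_relators_def Let_def free_gen_def free_eval_add free_eval_mult
        free_eval_diff)
  then show ?case by (simp add: free_eval_mult)
qed (simp_all add: free_eval_add)

instantiation super_jordan_plane :: (comm_ring_1) ring_1
begin

lift_definition zero_super_jordan_plane :: "'a super_jordan_plane" is 0 .

lift_definition one_super_jordan_plane :: "'a super_jordan_plane" is 1 .

lift_definition plus_super_jordan_plane ::
    "'a super_jordan_plane \<Rightarrow> 'a super_jordan_plane \<Rightarrow> 'a super_jordan_plane" is "(+)"
  unfolding sjp_rel_def by (metis add_diff_add two_sided_ideal.add)

lift_definition uminus_super_jordan_plane ::
    "'a super_jordan_plane \<Rightarrow> 'a super_jordan_plane" is uminus
  unfolding sjp_rel_def by (metis minus_diff_minus two_sided_ideal_minus)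

lift_definition minus_super_jordan_plane ::
    "'a super_jordan_plane \<Rightarrow> 'a super_jordan_plane \<Rightarrow> 'a super_jordan_plane" is "(-)"
proof -
  fix p p' q q' :: "(sjp_gen, 'a) free_algebra"
  assume "sjp_rel p p'" "sjp_rel q q'"
  then have "(p - p') + - (q - q') \<in> two_sided_ideal sjp_relators"
    unfolding sjp_rel_def by (intro two_sided_ideal.add two_sided_ideal_minus)
  then show "sjp_rel (p - q) (p' - q')"
    unfolding sjp_rel_def by (simp add: algebra_simps)
qed

lift_definition times_super_jordan_plane ::
    "'a super_jordan_plane \<Rightarrow> 'a super_jordan_plane \<Rightarrow> 'a super_jordan_plane" is "(*)"
proof -
  fix p p' q q' :: "(sjp_gen, 'a) free_algebra"
  assume "sjp_rel p p'" "sjp_rel q q'"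
  then have "(p - p') * q + p' * (q - q') \<in> two_sided_ideal sjp_relators"
    unfolding sjp_rel_def
    by (intro two_sided_ideal.add two_sided_ideal_mult_left two_sided_ideal_mult_right)
  then show "sjp_rel (p * q) (p' * q')"
    unfolding sjp_rel_def by (simp add: algebra_simps)
qed

instance
proof
  show "(0 :: 'a super_jordan_plane) \<noteq> 1"
  proof
    assume "(0 :: 'a super_jordan_plane) = 1"
    then have "(0 - 1 :: (sjp_gen, 'a) free_algebra) \<in> two_sided_ideal sjp_relators"
      by transfer (simp add: sjp_rel_def)
    then show False
      using free_eval_sjp_ideal[of "0 - 1" 0] by (simp add: free_eval_minus)
  qed
qed (transfer; simp add: sjp_rel_def algebra_simps two_sided_ideal.zero)+

end

lift_definition sjp_scalar :: "'k::comm_ring_1 \<Rightarrow> 'k super_jordan_plane" is free_scalar .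

lift_definition sjp_x1 :: "'k::comm_ring_1 super_jordan_plane" is "free_gen G1" .

lift_definition sjp_x2 :: "'k::comm_ring_1 super_jordan_plane" is "free_gen G2" .

lemma sjp_x1_square: "sjp_x1 * sjp_x1 = (0 :: 'k::comm_ring_1 super_jordan_plane)"
  by transfer (auto simp: sjp_rel_def sjp_relators_def Let_def intro!: two_sided_ideal_base)

lemma sjp_x2_x21:
  fixes x21 :: "'k::comm_ring_1 super_jordan_plane"
  defines "x21 \<equiv> sjp_x1 * sjp_x2 + sjp_x2 * sjp_x1"
  shows "sjp_x2 * x21 = x21 * sjp_x2 + sjp_x1 * x21"
  unfolding x21_def
  by transfer (auto simp: sjp_rel_def sjp_relators_def Let_def intro!: two_sided_ideal_base)

section \<open>Left modules\<close>

text \<open>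
  The library's \<^locale>\<open>module\<close> requires a commutative ring of scalars.  A module is given here by its
  action on a whole type \<open>'v\<close>.
\<close>

locale left_module =
  fixes act :: "'r::ring_1 \<Rightarrow> 'v::ab_group_add \<Rightarrow> 'v"
  assumes act_add_right: "act r (v + w) = act r v + act r w"
    and act_add_left: "act (r + s) v = act r v + act s v"
    and act_mult: "act (r * s) v = act r (act s v)"
    and act_one: "act 1 v = v"
begin

definition submodule :: "'v set \<Rightarrow> bool" where
  "submodule W \<longleftrightarrow>
     0 \<in> W \<and> (\<forall>v\<in>W. \<forall>w\<in>W. v + w \<in> W) \<and> (\<forall>r. \<forall>v\<in>W. act r v \<in> W)"

end

locale simple_left_module = left_module act
  for act :: "'r::ring_1 \<Rightarrow> 'v::ab_group_add \<Rightarrow> 'v" +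
  assumes nontrivial: "\<exists>v::'v. v \<noteq> 0"
    and simple: "submodule W \<Longrightarrow> W = {0} \<or> W = UNIV"

definition left_module_iso ::
    "('r::ring_1 \<Rightarrow> 'v::ab_group_add \<Rightarrow> 'v) \<Rightarrow> ('r \<Rightarrow> 'w::ab_group_add \<Rightarrow> 'w) \<Rightarrow> ('v \<Rightarrow> 'w) \<Rightarrow> bool" where
  "left_module_iso act act' f \<longleftrightarrow>
     bij f \<and> (\<forall>v w. f (v + w) = f v + f w) \<and> (\<forall>r v. f (act r v) = act' r (f v))"

definition left_module_isomorphic ::
    "('r::ring_1 \<Rightarrow> 'v::ab_group_add \<Rightarrow> 'v) \<Rightarrow> ('r \<Rightarrow> 'w::ab_group_add \<Rightarrow> 'w) \<Rightarrow> bool" where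
  "left_module_isomorphic act act' \<longleftrightarrow> (\<exists>f. left_module_iso act act' f)"

section \<open>Modules over the super Jordan plane\<close>

text \<open>The base field acts on a module through the unit map \<^const>\<open>sjp_scalar\<close>.\<close>

definition sjp_finite_dimensional ::
    "('k::field super_jordan_plane \<Rightarrow> 'v::ab_group_add \<Rightarrow> 'v) \<Rightarrow> bool" where
  "sjp_finite_dimensional act \<longleftrightarrow>
     (\<exists>Basis. finite_dimensional_vector_space (\<lambda>c. act (sjp_scalar c)) Basis)"

lemma sjp_scalar_add: "sjp_scalar (c + d) = sjp_scalar c + sjp_scalar d"
  by transfer (simp add: free_scalar_def single_add sjp_rel_def two_sided_ideal.zero)

lemma sjp_scalar_mult: "sjp_scalar (c * d) = sjp_scalar c * sjp_scalar d"
  by transfer (simp add: free_scalar_def mult_single sjp_rel_def two_sided_ideal.zero)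

lemma sjp_scalar_one: "sjp_scalar 1 = 1"
  by transfer (simp add: free_scalar_def sjp_rel_def two_sided_ideal.zero)

lemma sjp_module_vector_space:
  fixes act :: "'k::field super_jordan_plane \<Rightarrow> 'v::ab_group_add \<Rightarrow> 'v"
  assumes "left_module act"
  shows "vector_space (\<lambda>c. act (sjp_scalar c))"
proof -
  interpret left_module act by fact
  show ?thesis
    by standard
       (simp_all add: act_add_right act_add_left act_one sjp_scalar_add sjp_scalar_one
          sjp_scalar_mult act_mult)
qed

lift_definition sjp_character :: "'k::comm_ring_1 \<Rightarrow> 'k super_jordan_plane \<Rightarrow> 'k"
  is "\<lambda>a. free_eval (sjp_values a)"
  unfolding sjp_rel_def by (metis eq_iff_diff_eq_0 free_eval_diff free_eval_sjp_ideal)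

definition sjp_one_dim :: "'k::field \<Rightarrow> 'k super_jordan_plane \<Rightarrow> 'k \<Rightarrow> 'k" where
  "sjp_one_dim a b v = sjp_character a b * v"

lemma left_module_sjp_one_dim: "left_module (sjp_one_dim a)"
proof -
  have add: "sjp_character a (b + c) = sjp_character a b + sjp_character a c" for b c
    by transfer (rule free_eval_add)
  have mult: "sjp_character a (b * c) = sjp_character a b * sjp_character a c" for b c
    by transfer (rule free_eval_mult)
  have one: "sjp_character a 1 = 1"
    by transfer (rule free_eval_one)
  show ?thesis
    by standard (simp_all add: sjp_one_dim_def add mult one algebra_simps)
qed

lemma sjp_one_dim_x1: "sjp_one_dim a sjp_x1 v = 0"
  unfolding sjp_one_dim_def by transfer (simp add: free_gen_def)

lemma sjp_one_dim_x2: "sjp_one_dim a sjp_x2 v = a * v"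
  unfolding sjp_one_dim_def by transfer (simp add: free_gen_def)

lemma sjp_one_dim_scalar: "sjp_one_dim a (sjp_scalar c) v = c * v"
  unfolding sjp_one_dim_def by transfer (simp add: free_scalar_def)

end

theory Submission
  imports Defs
begin

text \<open>
  On a simple module put \<open>Z = x\<^sub>1 x\<^sub>2 + x\<^sub>2 x\<^sub>1\<close>.  The relations give \<open>x\<^sub>1 Z = Z x\<^sub>1\<close> and
  \<open>x\<^sub>2 Z = Z x\<^sub>2 + x\<^sub>1 Z\<close>, so kernel and range of \<open>Z\<close> are submodules and \<open>Z\<close> is zero or bijective.
  Moreover \<open>x\<^sub>2\<^sup>2 Z - Z x\<^sub>2\<^sup>2 = Z\<^sup>2\<close>; if \<open>Z\<close> were invertible, then \<open>Z\<^sup>-\<^sup>1\<close> and \<open>x\<^sub>2\<^sup>2\<close> would satisfy the canonical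
  commutation relation, which is impossible in finite dimension and characteristic 0.  Hence \<open>Z = 0\<close>,
  the kernel of \<open>x\<^sub>1\<close> is a submodule, nonzero as \<open>x\<^sub>1\<^sup>2 = 0\<close>, so \<open>x\<^sub>1\<close> acts by zero, and an eigenvector of
  \<open>x\<^sub>2\<close> spans the module.
\<close>

section \<open>Polynomials in a linear operator\<close>

locale linear_operator = vector_space scale
  for scale :: "'k::field \<Rightarrow> 'v::ab_group_add \<Rightarrow> 'v" +
  fixes T :: "'v \<Rightarrow> 'v"
  assumes T_add: "T (v + w) = T v + T w"
    and T_scale: "T (scale c v) = scale c (T v)"
begin

lemma T_zero [simp]: "T 0 = 0"
  using T_scale[of 0 0] by simp

text \<open>Horner form of \<open>p(T) v\<close>.\<close>

definition poly_apply :: "'k poly \<Rightarrow> 'v \<Rightarrow> 'v" where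
  "poly_apply p v = fold_coeffs (\<lambda>c w. scale c v + T w) p 0"

lemma poly_apply_0 [simp]: "poly_apply 0 v = 0"
  by (simp add: poly_apply_def)

lemma poly_apply_pCons [simp]: "poly_apply (pCons c p) v = scale c v + T (poly_apply p v)"
  by (cases "c = 0 \<and> p = 0") (auto simp: poly_apply_def)

lemma poly_apply_add: "poly_apply (p + q) v = poly_apply p v + poly_apply q v"
  by (induction p q rule: poly_induct2) (simp_all add: T_add scale_left_distrib)

lemma poly_apply_smult: "poly_apply (smult c p) v = scale c (poly_apply p v)"
  by (induction p) (simp_all add: T_scale scale_right_distrib)

lemma poly_apply_monom: "poly_apply (monom c n) v = scale c ((T ^^ n) v)"
  by (induction n) (simp_all add: monom_0 monom_Suc T_scale)

lemma poly_apply_sum: "poly_apply (\<Sum>i\<in>I. p i) v = (\<Sum>i\<in>I. poly_apply (p i) v)"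
  by (induction I rule: infinite_finite_induct) (simp_all add: poly_apply_add)

end

locale finite_dim_operator = linear_operator scale T + finite_dimensional_vector_space scale Basis
  for scale :: "'k::field \<Rightarrow> 'v::ab_group_add \<Rightarrow> 'v" and T Basis
begin

text \<open>The iterates of \<open>v\<close> under \<open>T\<close> cannot form an infinite
  independent set. Independence of a set does not see repeated iterates, hence the case
  split.\<close>

lemma exists_annihilating_poly: "\<exists>p. p \<noteq> 0 \<and> poly_apply p v = 0"
proof (cases "inj (\<lambda>n. (T ^^ n) v)")
  case True
  let ?f = "\<lambda>n. (T ^^ n) v"
  have "infinite (range ?f)"
    using True range_inj_infinite by blast
  then have "dependent (range ?f)"
    using finiteI_independent by blast
  then obtain S u w where S: "finite S" "S \<subseteq> range ?f" "(\<Sum>x\<in>S. scale (u x) x) = 0"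
    and w: "w \<in> S" "u w \<noteq> 0"
    unfolding dependent_explicit by blast
  \<comment> \<open>Choosing an exponent for each vector of \<open>S\<close> turns the linear
    relation into a polynomial.\<close>
  define k where "k = inv ?f"
  have k: "(T ^^ k x) v = x" if "x \<in> S" for x
    using that S(2) f_inv_into_f[of x ?f UNIV] by (auto simp: k_def)
  define p where "p = (\<Sum>x\<in>S. monom (u x) (k x))"
  have "poly_apply p v = 0"
    using S(3) k by (simp add: p_def poly_apply_sum poly_apply_monom)
  \<comment> \<open>Distinct vectors of \<open>S\<close> have distinct exponents, so only the
    monomial of \<open>w\<close> contributes.\<close>
  moreover have "coeff p (k w) = (\<Sum>x\<in>S. if x = w then u x else 0)"
    unfolding p_def coeff_sum using k w(1) by (intro sum.cong refl) (simp, metis)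
  then have "coeff p (k w) = u w"
    using S(1) w(1) by simp
  then have "p \<noteq> 0"
    using w(2) by auto
  ultimately show ?thesis by blast
next
  case False
  then obtain m n where mn: "m \<noteq> n" "(T ^^ m) v = (T ^^ n) v"
    by (auto simp: inj_on_def)
  let ?p = "monom (1 :: 'k) m + monom (- 1) n"
  have "coeff ?p m = 1"
    using mn(1) by simp
  then have "?p \<noteq> 0"
    by (metis coeff_0 zero_neq_one)
  moreover have "poly_apply ?p v = 0"
    using mn(2) by (simp add: poly_apply_add poly_apply_monom)
  ultimately show ?thesis by blast
qed

text \<open>Take a nonzero annihilator of least degree; a nonzero constant cannot kill
  \<open>v\<close>.\<close>

lemma exists_minimal_annihilating_poly:
  assumes "v \<noteq> 0"
  obtains p where "degree p > 0" "poly_apply p v = 0"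
    "\<And>q. q \<noteq> 0 \<Longrightarrow> degree q < degree p \<Longrightarrow> poly_apply q v \<noteq> 0"
proof -
  obtain p where p: "p \<noteq> 0 \<and> poly_apply p v = 0"
    "\<And>q. q \<noteq> 0 \<and> poly_apply q v = 0 \<Longrightarrow> degree p \<le> degree q"
    using exists_annihilating_poly[of v]
      ex_has_least_nat[of "\<lambda>p. p \<noteq> 0 \<and> poly_apply p v = 0" _ degree] by blast
  have "degree p > 0"
  proof (rule ccontr)
    assume "\<not> degree p > 0"
    then obtain c where "p = [:c:]"
      using degree_eq_zeroE by blast
    then show False
      using p(1) assms by simp
  qed
  then show thesis
    using that p by (metis not_le)
qed

end

text \<open>Splitting a root \<open>a\<close> off a minimal annihilator of \<open>v\<close> leaves a
  cofactor \<open>q\<close> of smaller degree, so \<open>q(T) v\<close> is nonzero, and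
  \<open>T - a\<close> kills it.\<close>

lemma exists_eigenvector:
  fixes scale :: "'k::alg_closed_field \<Rightarrow> 'v::ab_group_add \<Rightarrow> 'v"
  assumes "finite_dim_operator scale T Basis" and "\<exists>v::'v. v \<noteq> 0"
  obtains a v where "v \<noteq> 0" "T v = scale a v"
proof -
  interpret finite_dim_operator scale T Basis by fact
  obtain v :: 'v where "v \<noteq> 0"
    using assms(2) by blast
  then obtain p where p: "degree p > 0" "poly_apply p v = 0"
    "\<And>q. q \<noteq> 0 \<Longrightarrow> degree q < degree p \<Longrightarrow> poly_apply q v \<noteq> 0"
    using exists_minimal_annihilating_poly by blast
  obtain a where "poly p a = 0"
    using alg_closed_imp_poly_has_root[OF p(1)] by blast
  then obtain q where q: "p = [:- a, 1:] * q"
    by (auto simp: poly_eq_0_iff_dvd)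
  have "q \<noteq> 0"
    using q p(1) by auto
  then have "degree p = Suc (degree q)"
    unfolding q by (subst degree_mult_eq) auto
  then have "poly_apply q v \<noteq> 0"
    using p(3) \<open>q \<noteq> 0\<close> by simp
  moreover have "T (poly_apply q v) = scale a (poly_apply q v)"
  proof -
    have "p = pCons 0 q + smult (- a) q"
      by (simp add: q)
    then show ?thesis
      using p(2) by (simp only: poly_apply_add poly_apply_smult poly_apply_pCons) simp
  qed
  ultimately show thesis
    by (rule that)
qed

text \<open>
  The Weyl algebra has no finite-dimensional module: with \<open>v\<close> an eigenvector of \<open>W\<close>, the commutation
  relation says that \<open>W\<close> acts on \<open>p(A) v\<close> as the eigenvalue plus differentiation of \<open>p\<close>, so
  differentiating the minimal polynomial of \<open>A\<close> at \<open>v\<close> gives a smaller annihilator.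
\<close>

lemma no_finite_dim_canonical_commutation:
  fixes scale :: "'k::{alg_closed_field, field_char_0} \<Rightarrow> 'v::ab_group_add \<Rightarrow> 'v"
  assumes A: "finite_dim_operator scale A Basis" and W: "finite_dim_operator scale W Basis"
    and comm: "\<And>v. W (A v) = A (W v) + v"
  shows "(v::'v) = 0"
proof (rule ccontr)
  assume "v \<noteq> 0"
  then obtain \<mu> u where u: "u \<noteq> 0" "W u = scale \<mu> u"
    using exists_eigenvector[OF W] by blast
  interpret A: finite_dim_operator scale A Basis by (rule A)
  interpret W: finite_dim_operator scale W Basis by (rule W)
  have W_poly: "W (A.poly_apply p u) =
      scale \<mu> (A.poly_apply p u) + A.poly_apply (pderiv p) u" for p
    by (induction p)
       (simp_all add: pderiv_pCons A.poly_apply_add W.T_add W.T_scale A.T_add A.T_scale comm u(2)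
          A.scale_right_distrib mult.commute add_ac)
  obtain p where p: "degree p > 0" "A.poly_apply p u = 0"
    "\<And>q. q \<noteq> 0 \<Longrightarrow> degree q < degree p \<Longrightarrow> A.poly_apply q u \<noteq> 0"
    using A.exists_minimal_annihilating_poly[OF u(1)] by blast
  have "A.poly_apply (pderiv p) u = 0"
    using W_poly[of p] p(2) by simp
  \<comment> \<open>Characteristic 0 enters here: a nonconstant polynomial has nonzero
    derivative.\<close>
  moreover have "pderiv p \<noteq> 0" "degree (pderiv p) < degree p"
    using p(1) by (auto simp: pderiv_eq_0_iff degree_pderiv)
  ultimately show False
    using p(3) by blast
qed

section \<open>Modules over the super Jordan plane\<close>

text \<open>Words are products of generators, so claims about the action reduce to scalars,
  \<open>sjp_x1\<close> and \<open>sjp_x2\<close>.\<close>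

lemma sjp_induct [case_names scalar x1 x2 add mult]:
  assumes "\<And>c. P (sjp_scalar c)" and "P sjp_x1" and "P sjp_x2"
    and "\<And>r s. P r \<Longrightarrow> P s \<Longrightarrow> P (r + s)" and "\<And>r s. P r \<Longrightarrow> P s \<Longrightarrow> P (r * s)"
  shows "P (r :: 'k::comm_ring_1 super_jordan_plane)"
proof (induction r rule: super_jordan_plane.abs_induct)
  case (1 p)
  show ?case
  proof (induction p rule: free_algebra_induct)
    case (single w c)
    have "P (abs_super_jordan_plane (Poly_Mapping.single (Word xs) c))" for xs
    \<comment> \<open>Peeling off the last letter keeps the coefficient on the left, down to the
      empty word, which gives a scalar.\<close>
    proof (induction xs rule: rev_induct)
      case Nil
      then show ?case
        using assms(1)[of c] by (simp add: sjp_scalar.abs_eq free_scalar_def zero_word_def)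
    next
      case (snoc x xs)
      have "P (abs_super_jordan_plane (free_gen x))"
        using assms(2,3) by (cases x) (simp_all add: sjp_x1_def sjp_x2_def)
      moreover have "Poly_Mapping.single (Word (xs @ [x])) c =
          Poly_Mapping.single (Word xs) c * free_gen x"
        by (simp add: free_gen_def mult_single plus_word_def)
      ultimately show ?case
        using assms(5) snoc by (simp flip: times_super_jordan_plane.abs_eq)
    qed
    then show ?case
      by (cases w) simp
  next
    case (add p q)
    then show ?case
      using assms(4) by (simp flip: plus_super_jordan_plane.abs_eq)
  qed
qed

text \<open>Scalars sit on the empty word, which is neutral for concatenation. Centrality makes
  every \<open>act r\<close> linear over the base field.\<close>

lemma sjp_scalar_central: "sjp_scalar c * r = r * sjp_scalar c"
proof transfer
  fix c :: 'a and p :: "(sjp_gen, 'a) free_algebra"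
  have "free_scalar c * p = p * free_scalar c"
    by (induction p rule: free_algebra_induct)
       (simp_all add: free_scalar_def mult_single mult.commute distrib_left distrib_right)
  then show "sjp_rel (free_scalar c * p) (p * free_scalar c)"
    by (simp add: sjp_rel_def two_sided_ideal.zero)
qed

lemma sjp_character_add: "sjp_character a (r + s) = sjp_character a r + sjp_character a s"
  by transfer (rule free_eval_add)

lemma sjp_character_mult: "sjp_character a (r * s) = sjp_character a r * sjp_character a s"
  by transfer (rule free_eval_mult)

lemma sjp_character_simps [simp]:
  "sjp_character a (sjp_scalar c) = c" "sjp_character a sjp_x1 = 0" "sjp_character a sjp_x2 = a"
  by (transfer; simp add: free_scalar_def free_gen_def)+

section \<open>Operator identities on a module\<close>

locale sjp_module = left_module act
  for act :: "'k::field super_jordan_plane \<Rightarrow> 'v::ab_group_add \<Rightarrow> 'v"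
begin

abbreviation scl :: "'k \<Rightarrow> 'v \<Rightarrow> 'v" where "scl c \<equiv> act (sjp_scalar c)"
abbreviation X :: "'v \<Rightarrow> 'v" where "X \<equiv> act sjp_x1"
abbreviation Y :: "'v \<Rightarrow> 'v" where "Y \<equiv> act sjp_x2"

definition Z :: "'v \<Rightarrow> 'v" where "Z v = X (Y v) + Y (X v)"

sublocale vector_space scl
  by (rule sjp_module_vector_space) (rule left_module_axioms)

lemma act_scl: "act r (scl c v) = scl c (act r v)"
  using act_mult[of r "sjp_scalar c" v] act_mult[of "sjp_scalar c" r v]
  by (simp add: sjp_scalar_central)

lemma act_operator: "linear_operator scl (act r)"
  by unfold_locales (simp_all add: act_add_right act_scl)

lemma act_zero [simp]: "act r 0 = 0"
  using act_add_right[of r 0 0] by simp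

lemma act_minus: "act r (- v) = - act r v"
  using act_add_right[of r v "- v"] by (simp add: eq_neg_iff_add_eq_0 add.commute)

lemma act_diff: "act r (v - w) = act r v - act r w"
  using act_add_right[of r v "- w"] by (simp add: act_minus)

lemma XX [simp]: "X (X v) = 0"
  using act_mult[of sjp_x1 sjp_x1 v] act_add_left[of 0 0 v] by (simp add: sjp_x1_square)

lemma Z_eq_act: "Z v = act (sjp_x1 * sjp_x2 + sjp_x2 * sjp_x1) v"
  by (simp add: Z_def act_add_left act_mult)

lemma Z_zero [simp]: "Z 0 = 0"
  by (simp add: Z_def)

lemma Z_add: "Z (v + w) = Z v + Z w"
  by (simp add: Z_eq_act act_add_right)

lemma Z_scl: "Z (scl c v) = scl c (Z v)"
  by (simp add: Z_eq_act act_scl)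

text \<open>Both sides reduce to \<open>X (Y (X v))\<close>, since \<open>X\<close> squares to
  zero.\<close>

lemma ZX: "Z (X v) = X (Z v)"
  by (simp add: Z_def act_add_right)

lemma YZ: "Y (Z v) = Z (Y v) + X (Z v)"
  unfolding Z_eq_act by (metis act_add_left act_mult sjp_x2_x21)

lemma YX: "Y (X v) = Z v - X (Y v)"
  by (simp add: Z_def)

text \<open>Moving \<open>Y\<close> past \<open>Z\<close> twice leaves the error term
  \<open>X (Z (Y v)) + Y (X (Z v))\<close>. It equals \<open>Z (Z v)\<close>, because applying
  \<open>X\<close> to \<open>YZ\<close> gives \<open>X (Z (Y v)) = X (Y (Z v))\<close>.\<close>

lemma YYZ: "Y (Y (Z v)) = Z (Y (Y v)) + Z (Z v)"
  by (simp add: YZ YX act_add_right ZX Z_add)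

lemma submoduleI:
  assumes "0 \<in> U" "\<And>v w. v \<in> U \<Longrightarrow> w \<in> U \<Longrightarrow> v + w \<in> U" "\<And>c v. v \<in> U \<Longrightarrow> scl c v \<in> U"
    and "\<And>v. v \<in> U \<Longrightarrow> X v \<in> U" "\<And>v. v \<in> U \<Longrightarrow> Y v \<in> U"
  shows "submodule U"
proof -
  have "\<forall>v\<in>U. act r v \<in> U" for r
    by (induction r rule: sjp_induct) (use assms in \<open>auto simp: act_add_left act_mult\<close>)
  then show ?thesis
    using assms(1,2) by (simp add: submodule_def)
qed

text \<open>The elements \<open>r\<close> with this property include scalars and generators and are
  closed under sums and products.\<close>

lemma act_eigenvector:
  assumes "X v = 0" "Y v = scl a v"
  shows "act r v = scl (sjp_character a r) v"
proof (induction r rule: sjp_induct)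
  case (mult r s)
  then show ?case
    by (simp add: act_mult act_scl[of r] sjp_character_mult mult.commute)
qed (simp_all add: assms act_add_left sjp_character_add scale_left_distrib)

end

section \<open>Consequences of simplicity\<close>

locale simple_sjp_module = sjp_module act + simple_left_module act
  for act :: "'k::field super_jordan_plane \<Rightarrow> 'v::ab_group_add \<Rightarrow> 'v"
begin

lemma Z_zero_or_bij: "(\<forall>v. Z v = 0) \<or> bij Z"
proof -
  have "Z (Y v) = 0" if "Z v = 0" for v
    using YZ[of v] that by simp
  then have ker: "submodule {v. Z v = 0}"
    by (intro submoduleI) (auto simp: Z_add Z_scl ZX)
  \<comment> \<open>With \<open>Z\<close> outermost on the right, the relations show that its range
    is stable under \<open>X\<close> and \<open>Y\<close>.\<close>
  have "X (Z v) = Z (X v)" "Y (Z v) = Z (Y v + X v)" for v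
    by (simp_all add: YZ Z_add ZX)
  then have ran: "submodule (range Z)"
    by (intro submoduleI) (auto simp flip: Z_add Z_scl intro: range_eqI[of 0 Z 0])
  show ?thesis
  proof (cases "\<forall>v. Z v = 0")
    case False
    then have "{v. Z v = 0} = {0}" "range Z = UNIV"
      using simple[OF ker] simple[OF ran] by blast+
    moreover have "inj Z"
    proof (rule injI)
      fix v w assume "Z v = Z w"
      then have "v - w \<in> {v. Z v = 0}"
        by (simp add: Z_eq_act act_diff)
      then show "v = w"
        unfolding \<open>{v. Z v = 0} = {0}\<close> by simp
    qed
    ultimately show ?thesis
      by (simp add: bij_def)
  qed simp
qed

lemma X_eq_zero:
  assumes "\<And>v. Z v = 0"
  shows "X v = 0"
proof -
  have "X (Y v) = 0" if "X v = 0" for v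
    using assms[of v] that by (simp add: Z_def)
  then have "submodule {v. X v = 0}"
    by (intro submoduleI) (auto simp: act_add_right act_scl)
  \<comment> \<open>Hence a zero kernel forces \<open>X v = 0\<close> just as a full kernel
    does.\<close>
  moreover have "X v \<in> {v. X v = 0}"
    by simp
  ultimately show ?thesis
    using simple by blast
qed

text \<open>The orbit map \<open>g\<close> from the one-dimensional module is a homomorphism; its
  range is a nonzero submodule, hence everything. The isomorphism is its inverse.\<close>

lemma isomorphic_one_dim_if_eigenvector:
  assumes v: "v \<noteq> 0" "X v = 0" "Y v = scl a v"
  shows "left_module_isomorphic act (sjp_one_dim a)"
proof -
  define g where "g c = scl c v" for c
  note act_v = act_eigenvector[OF v(2,3)]
  have g_add: "g (c + d) = g c + g d" for c d
    by (simp add: g_def scale_left_distrib)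
  have g_act: "g (sjp_one_dim a r c) = act r (g c)" for r c
    unfolding g_def sjp_one_dim_def act_scl[of r] act_v[of r] by (simp add: mult.commute)
  have "range g = {0} \<or> range g = UNIV"
  proof (intro simple submoduleI)
    show "0 \<in> range g"
      by (rule range_eqI[of _ _ 0]) (simp add: g_def)
  qed (auto simp flip: g_add g_act)
  moreover have "v = g 1"
    by (simp add: g_def)
  ultimately have "surj g"
    using v(1) by blast
  moreover have "inj g"
    using v(1) by (auto simp: inj_def g_def)
  ultimately have "bij g"
    by (simp add: bij_def)
  then have "left_module_iso act (sjp_one_dim a) (inv g)"
    unfolding left_module_iso_def
    by (metis bij_imp_bij_inv bij_inv_eq_iff g_act g_add)
  then show ?thesis
    by (auto simp: left_module_isomorphic_def)
qed

end

section \<open>Vanishing of \<open>Z\<close> and the classification\<close>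

lemma Z_eq_zero:
  fixes act :: "'k::{alg_closed_field, field_char_0} super_jordan_plane \<Rightarrow> 'v::ab_group_add \<Rightarrow> 'v"
  assumes "simple_sjp_module act" and "sjp_finite_dimensional act"
  shows "sjp_module.Z act v = 0"
proof -
  interpret simple_sjp_module act by fact
  obtain Basis where fd: "finite_dimensional_vector_space scl Basis"
    using assms(2) unfolding sjp_finite_dimensional_def by blast
  have False if "bij Z"
  proof -
    define W where "W = inv Z"
    have WZ: "W (Z v) = v" and ZW: "Z (W v) = v" for v
      using bij_is_inj[OF that] bij_is_surj[OF that] by (simp_all add: W_def surj_f_inv_f)
    have "W (v + w) = W v + W w" "W (scl c v) = scl c (W v)" for v w c
      using WZ[of "W v + W w"] WZ[of "scl c (W v)"] by (simp_all add: Z_add Z_scl ZW)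
    then have "linear_operator scl W"
      by unfold_locales
    then have "finite_dim_operator scl W Basis"
      using fd by (simp add: finite_dim_operator_def)
    moreover have "act (sjp_x2 * sjp_x2) = (\<lambda>v. Y (Y v))"
      by (simp add: fun_eq_iff act_mult)
    then have "finite_dim_operator scl (\<lambda>v. Y (Y v)) Basis"
      using fd act_operator[of "sjp_x2 * sjp_x2"] by (simp add: finite_dim_operator_def)
    \<comment> \<open>Evaluating \<open>YYZ\<close> at \<open>W v\<close> and cancelling
      \<open>Z\<close> yields the canonical commutation relation, with \<open>W\<close> in the role
      of differentiation.\<close>
    moreover have "W (Y (Y v)) = Y (Y (W v)) + v" for v
    proof -
      have "Y (Y v) = Z (Y (Y (W v)) + v)"
        using YYZ[of "W v"] by (simp add: ZW Z_add)
      then show ?thesis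
        by (simp add: WZ)
    qed
    ultimately have "\<forall>v::'v. v = 0"
      using no_finite_dim_canonical_commutation by blast
    then show False
      using nontrivial by blast
  qed
  then show ?thesis
    using Z_zero_or_bij by blast
qed

text \<open>The parameter is the eigenvalue of \<open>sjp_x2\<close>: pull 1 back along
  \<open>f\<close> to an eigenvector \<open>w\<close> for \<open>a\<close>, then push it along
  \<open>g\<close>, where the eigenvalue is \<open>b\<close>.\<close>

lemma sjp_one_dim_parameter_unique:
  assumes "left_module_isomorphic act (sjp_one_dim a)"
    and "left_module_isomorphic act (sjp_one_dim b)"
  shows "a = b"
proof -
  obtain f g where f: "left_module_iso act (sjp_one_dim a) f"
    and g: "left_module_iso act (sjp_one_dim b) g"
    using assms by (auto simp: left_module_isomorphic_def)
  obtain w where w: "f w = 1"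
    using f by (metis bij_pointE left_module_iso_def)
  have "f (act sjp_x2 w) = f (act (sjp_scalar a) w)"
    using f by (simp add: left_module_iso_def sjp_one_dim_x2 sjp_one_dim_scalar)
  then have "act sjp_x2 w = act (sjp_scalar a) w"
    using f unfolding left_module_iso_def by (metis bij_is_inj injD)
  then have "b * g w = a * g w"
    using g unfolding left_module_iso_def by (metis sjp_one_dim_x2 sjp_one_dim_scalar)
  moreover have "g w \<noteq> 0"
  proof
    assume "g w = 0"
    moreover have "g 0 = 0" "f 0 = 0"
      using f g by (metis left_module_iso_def add_cancel_right_right)+
    ultimately have "w = 0"
      using g by (metis bij_pointE left_module_iso_def)
    then show False
      using w \<open>f 0 = 0\<close> by simp
  qed
  ultimately show ?thesis
    by simp
qed

theorem theorem2p6: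
  fixes act :: "'k::{alg_closed_field, field_char_0} super_jordan_plane \<Rightarrow> 'v::ab_group_add \<Rightarrow> 'v"
  assumes "simple_left_module act"
    and "sjp_finite_dimensional act"
  shows "\<exists>!a. left_module_isomorphic act (sjp_one_dim a)"
proof -
  interpret simple_left_module act by fact
  interpret simple_sjp_module act by unfold_locales
  obtain Basis where "finite_dimensional_vector_space scl Basis"
    using assms(2) unfolding sjp_finite_dimensional_def by blast
  then have "finite_dim_operator scl Y Basis"
    using act_operator by (simp add: finite_dim_operator_def)
  then obtain a v where "v \<noteq> 0" "Y v = scl a v"
    using exists_eigenvector nontrivial by metis
  moreover have "X v = 0"
    using Z_eq_zero[OF simple_sjp_module_axioms assms(2)] by (rule X_eq_zero)
  ultimately have "left_module_isomorphic act (sjp_one_dim a)"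
    using isomorphic_one_dim_if_eigenvector by blast
  then show ?thesis
    using sjp_one_dim_parameter_unique by blast
qed

end
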